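(* Let $X$ be any finite simplicial complex. Then there exists a digraph $G$ without loops such that $\overrightarrow{\mathcal{N}}(G)\cong X$ as simplicial complexes.
   Context: A digraph $G$ consists of a finite vertex set $V(G)$ and an edge set $E(G)\subseteq V(G)\times V(G)$. For $v\in V(G)$ put $\overrightarrow{N}_G(v)=\{w:(v,w)\in E(G)\}$. The out-neighborhood complex $\overrightarrow{\mathcal{N}}(G)$ is the simplicial complex on vertex set $\{v\in V(G):\mathrm{indeg}(v)>0\}$ generated by the sets $\overrightarrow{N}_G(v)$, $v\in V(G)$ (a nonempty set of vertices is a face iff it is contained in some $\overrightarrow{N}_G(v)$). *)

theory Defs
  imports "Graph_Theory.Graph_Theory"
begin

text \<open>
  Abstract simplicial complexes, with an explicit vertex set. The empty simplex is not recorded as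
  a face, and every vertex spans a face, so that the vertex set is the union of the faces.
  The complex without vertices is allowed.
\<close>

record 'a scomplex =
  vertices :: "'a set"
  faces :: "'a set set"

definition simplicial_complex :: "'a scomplex \<Rightarrow> bool" where
  "simplicial_complex K \<longleftrightarrow>
     (\<forall>\<sigma>\<in>faces K. finite \<sigma> \<and> \<sigma> \<noteq> {} \<and> \<sigma> \<subseteq> vertices K) \<and>
     (\<forall>v\<in>vertices K. {v} \<in> faces K) \<and>
     (\<forall>\<sigma>\<in>faces K. \<forall>\<tau>. \<tau> \<subseteq> \<sigma> \<and> \<tau> \<noteq> {} \<longrightarrow> \<tau> \<in> faces K)"

definition finite_simplicial_complex :: "'a scomplex \<Rightarrow> bool" where
  "finite_simplicial_complex K \<longleftrightarrow> simplicial_complex K \<and> finite (vertices K)"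

definition scomplex_iso :: "'a scomplex \<Rightarrow> 'b scomplex \<Rightarrow> bool" where
  "scomplex_iso K L \<longleftrightarrow>
     (\<exists>f. bij_betw f (vertices K) (vertices L) \<and>
          (\<forall>\<sigma>. \<sigma> \<subseteq> vertices K \<longrightarrow> (\<sigma> \<in> faces K \<longleftrightarrow> f ` \<sigma> \<in> faces L)))"

text \<open>
  Digraphs whose arc set is a set of ordered pairs of vertices are those of type
  \<open>'a pair_pre_digraph\<close>; finite ones form the locale \<open>pair_fin_digraph\<close> and finite loopless ones
  the locale \<open>pair_digraph\<close>.
\<close>

definition out_neighborhood :: "'a pair_pre_digraph \<Rightarrow> 'a \<Rightarrow> 'a set" where
  "out_neighborhood G v = {w. (v, w) \<in> parcs G}"

definition out_neighborhood_complex :: "'a pair_pre_digraph \<Rightarrow> 'a scomplex" where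
  "out_neighborhood_complex G =
     \<lparr> vertices = {v \<in> pverts G. in_degree (with_proj G) v > 0},
       faces = {\<sigma>. \<sigma> \<noteq> {} \<and> (\<exists>v\<in>pverts G. \<sigma> \<subseteq> out_neighborhood G v)} \<rparr>"

lemma (in pair_fin_digraph) in_degree_pos_iff:
  "in_degree (with_proj G) v > 0 \<longleftrightarrow> (\<exists>u. (u, v) \<in> parcs G)"
proof -
  have "finite (in_arcs (with_proj G) v)"
    using pair_finite_arcs by (auto simp: in_arcs_def)
  then show ?thesis
    by (auto simp: in_degree_def card_gt_0_iff in_arcs_def)
qed

lemma (in pair_fin_digraph) finite_simplicial_complex_out_neighborhood_complex:
  "finite_simplicial_complex (out_neighborhood_complex G)"
proof -
  have out: "out_neighborhood G v \<subseteq> {w \<in> pverts G. \<exists>u. (u, w) \<in> parcs G}" for v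
    by (auto simp: out_neighborhood_def dest: in_arcsD2)
  have fin: "finite {w \<in> pverts G. \<exists>u. (u, w) \<in> parcs G}"
    using pair_finite_verts by simp
  have out_fin: "finite (out_neighborhood G v)" for v
    using out fin by (rule finite_subset)
  have sing: "\<exists>v\<in>pverts G. w \<in> out_neighborhood G v" if "(u, w) \<in> parcs G" for u w
    using that by (auto simp: out_neighborhood_def dest: in_arcsD1)
  show ?thesis
    unfolding finite_simplicial_complex_def simplicial_complex_def
    using fin out_fin out sing
    by (simp add: out_neighborhood_complex_def in_degree_pos_iff) (meson finite_subset subset_trans)
qed

end

theory Submission
  imports Defs
begin

text \<open>
  Orient the incidence graph of the complex from faces to vertices: the nodes of the digraph are
  the vertices and the faces of \<open>X\<close>, with an arc from each face to each of its vertices. This is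
  bipartite, so it has no loops. The node of a face has that face as its out-neighborhood, whereas
  the node of a vertex has empty out-neighborhood; so the nonempty generators of the out-neighborhood
  complex are exactly the faces of \<open>X\<close>, and since these are already closed under nonempty subsets,
  nothing new is generated. The nodes of positive in-degree are the vertices of \<open>X\<close>, because each
  vertex lies in at least the face that it spans, and no arc enters the node of a face.

  To have natural numbers as nodes, the \<open>n\<close> vertices of \<open>X\<close> are numbered from \<open>0\<close> and its faces
  from \<open>n\<close>; the isomorphism is the numbering of the vertices.
\<close>

theorem proposition4p7:
  fixes X :: "'a scomplex"
  assumes "finite_simplicial_complex X"
  shows "\<exists>G :: nat pair_pre_digraph. pair_digraph G \<and> scomplex_iso (out_neighborhood_complex G) X"
proof -
  have fin_V: "finite (vertices X)"
    and face_sub: "\<And>\<sigma>. \<sigma> \<in> faces X \<Longrightarrow> \<sigma> \<subseteq> vertices X"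
    and face_ne: "{} \<notin> faces X"
    and singleton: "\<And>v. v \<in> vertices X \<Longrightarrow> {v} \<in> faces X"
    and face_down: "\<And>\<sigma> \<tau>. \<sigma> \<in> faces X \<Longrightarrow> \<tau> \<subseteq> \<sigma> \<Longrightarrow> \<tau> \<noteq> {} \<Longrightarrow> \<tau> \<in> faces X"
    using assms unfolding finite_simplicial_complex_def simplicial_complex_def by blast+
  have fin_F: "finite (faces X)"
    using fin_V face_sub by (intro finite_subset[of "faces X" "Pow (vertices X)"]) auto
  define n m where "n = card (vertices X)" and "m = card (faces X)"
  obtain f where f: "bij_betw f {0..<n} (vertices X)"
    using ex_bij_betw_nat_finite[OF fin_V] n_def by blast
  obtain g where g: "bij_betw g {0..<m} (faces X)"
    using ex_bij_betw_nat_finite[OF fin_F] m_def by blast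
  have f_img: "f ` {0..<n} = vertices X" and g_img: "g ` {0..<m} = faces X"
    using f g by (auto simp: bij_betw_def)
  define G :: "nat pair_pre_digraph" where
    "G = \<lparr> pverts = {0..<n + m}, parcs = {(n + j, i) | i j. i < n \<and> j < m \<and> f i \<in> g j} \<rparr>"
  have pv: "pverts G = {0..<n + m}"
    and pa: "parcs G = {(n + j, i) | i j. i < n \<and> j < m \<and> f i \<in> g j}"
    by (simp_all add: G_def)
  have "finite (parcs G)"
    by (rule finite_subset[of _ "{0..<n + m} \<times> {0..<n}"]) (auto simp: pa)
  then interpret G: pair_digraph G
    by unfold_locales (auto simp: pv pa)
  have vertices_G: "vertices (out_neighborhood_complex G) = {0..<n}"
  proof -
    have "\<exists>u. (u, i) \<in> parcs G" if "i < n" for i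
    proof -
      have "{f i} \<in> faces X"
        using that f_img singleton by force
      then obtain j where "j < m" "g j = {f i}"
        using g_img by (metis atLeastLessThan_iff imageE)
      then show ?thesis
        using that by (auto simp: pa)
    qed
    then show ?thesis
      by (auto simp: out_neighborhood_complex_def G.in_degree_pos_iff pv) (auto simp: pa)
  qed
  have "\<sigma> \<in> faces (out_neighborhood_complex G) \<longleftrightarrow> f ` \<sigma> \<in> faces X"
    if \<sigma>: "\<sigma> \<subseteq> {0..<n}" for \<sigma>
  proof
    assume "\<sigma> \<in> faces (out_neighborhood_complex G)"
    then obtain v where ne: "\<sigma> \<noteq> {}" and v: "\<And>i. i \<in> \<sigma> \<Longrightarrow> (v, i) \<in> parcs G"
      by (auto simp: out_neighborhood_complex_def out_neighborhood_def)
    \<comment> \<open>Nonemptiness of \<open>\<sigma>\<close> forces its common in-neighbor to be the node of a face.\<close>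
    then obtain j where j: "v = n + j" "j < m"
      by (fastforce simp: pa)
    have "f ` \<sigma> \<subseteq> g j"
      using v by (fastforce simp: pa j)
    moreover have "g j \<in> faces X"
      using j g_img by auto
    ultimately show "f ` \<sigma> \<in> faces X"
      using face_down ne by blast
  next
    assume face: "f ` \<sigma> \<in> faces X"
    then obtain j where j: "j < m" "g j = f ` \<sigma>"
      using g_img by (metis atLeastLessThan_iff imageE)
    have "\<sigma> \<noteq> {}"
      using face face_ne by auto
    moreover have "\<sigma> \<subseteq> out_neighborhood G (n + j)"
      using \<sigma> j by (auto simp: out_neighborhood_def pa)
    moreover have "n + j \<in> pverts G"
      using j by (simp add: pv)
    ultimately show "\<sigma> \<in> faces (out_neighborhood_complex G)"
      unfolding out_neighborhood_complex_def by auto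
  qed
  then have "scomplex_iso (out_neighborhood_complex G) X"
    unfolding scomplex_iso_def vertices_G using f by blast
  then show ?thesis
    using G.pair_digraph_axioms by blast
qed

end
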